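(* Let $1\le r<n$ be integers and let $f:\mathbb{R}^{n\times n}\to\mathbb{R}$ be twice differentiable, satisfying Assumptions A1 (with constants $L\ge\mu>0$) and A2 (with unconstrained minimizer $\mathbf{X}_*$ of rank $r_*\le r$) of the context. Put $\kappa_f=L/\mu$. Let $\mathbf{X}^{(0)}\in\mathbb{R}^{n\times n}$ be any initialization of rank at most $r$ with $$f(\mathbf{X}^{(0)})-f(\mathbf{X}_* )\le 0.01\,\sigma_{r_*}(\mathbf{X}_* )^2\,\mu/\kappa_f ,$$ let $0<\eta<\frac{1}{2L}$, and let $\mathbf{X}^{(k+1)}=\mathcal{P}_r\big(\mathbf{X}^{(k)}-\eta\nabla f(\mathbf{X}^{(k)})\big)$ for $k\ge 0$ be the iterates of projected gradient descent (ProjGD) with step size $\eta$. Then $\mathbf{X}^{(k)}$ converges linearly to $\mathbf{X}_*$, and for every $k\ge 0$ (with $f(\mathbf{X}^{(k)})\ne f(\mathbf{X}_* )$) $$\frac{f(\mathbf{X}^{(k+1)})-f(\mathbf{X}_* )}{f(\mathbf{X}^{(k)})-f(\mathbf{X}_* )}\le 1-\frac{4}{27\kappa_f}\big(\eta L-\eta^2L^2\big).$$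
   Context: $\|\cdot\|_F$ and $\langle\cdot,\cdot\rangle$ are the Frobenius norm and inner product; $\sigma_i(\cdot)$ is the $i$-th largest singular value. $\mathcal{P}_r(\mathbf{Y})$ denotes a nearest matrix to $\mathbf{Y}$ of rank at most $r$ in Frobenius norm (truncated SVD keeping the top $r$ singular triples; any choice in case of ties). Assumption A1 (rank-$2r$ restricted smoothness and strong convexity): for all $\mathbf{X},\mathbf{X}',\mathbf{E}\in\mathbb{R}^{n\times n}$ of rank at most $2r$, $\|\nabla f(\mathbf{X})-\nabla f(\mathbf{X}')\|_F\le L\|\mathbf{X}-\mathbf{X}'\|_F$ and $\langle\nabla^2 f(\mathbf{X})[\mathbf{E}],\mathbf{E}\rangle\ge\mu\|\mathbf{E}\|_F^2$. Assumption A2: $f$ has a minimizer $\mathbf{X}_*=\arg\min_{\mathbf{X}\in\mathbb{R}^{n\times n}}f(\mathbf{X})$ over all of $\mathbb{R}^{n\times n}$, and $\mathrm{rank}(\mathbf{X}_* )=r_*\le r$. *)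

theory Defs
  imports "HOL-Analysis.Analysis" "HOL-Computational_Algebra.Polynomial"
begin

text \<open>
  On \<^typ>\<open>real^'n^'m\<close>, \<^const>\<open>norm\<close> and the inner product are already the Frobenius norm and
  the Frobenius inner product, as iterated Euclidean structures.
\<close>

definition charpoly :: "real^'n^'n \<Rightarrow> real poly" where
  "charpoly A = det (\<chi> i j. (if i = j then [:0, 1:] else 0) - [:A $ i $ j:])"

text \<open>
  The singular values are the square roots of the eigenvalues of $A^T A$, listed with multiplicity
  (a symmetric matrix has only real eigenvalues, so the list has length
  \<^term>\<open>CARD('n)\<close>).
\<close>

definition singular_values :: "real^'n^'n \<Rightarrow> real list" where
  "singular_values A =
     rev (sorted_list_of_multiset (image_mset sqrt (proots (charpoly (transpose A ** A)))))"

text \<open>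
  The index starts at 1; outside the range of the list, in particular at index 0, the value is 0.
\<close>

definition singular_value :: "nat \<Rightarrow> real^'n^'n \<Rightarrow> real" where
  "singular_value i A =
     (if 1 \<le> i \<and> i \<le> length (singular_values A) then singular_values A ! (i - 1) else 0)"

text \<open>
  A nearest matrix of rank at most \<open>r\<close> need not be unique, so the projection is a relation.
\<close>

definition is_rank_projection :: "nat \<Rightarrow> real^'n^'m \<Rightarrow> real^'n^'m \<Rightarrow> bool" where
  "is_rank_projection r Y Z \<longleftrightarrow> is_arg_min (\<lambda>W. norm (Y - W)) (\<lambda>W. rank W \<le> r) Z"

text \<open>
  Linear convergence in the root sense: the error is bounded by a geometric sequence.
\<close>

definition converges_linearly :: "(nat \<Rightarrow> 'a::real_normed_vector) \<Rightarrow> 'a \<Rightarrow> bool" where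
  "converges_linearly X l \<longleftrightarrow> (\<exists>C q. 0 \<le> q \<and> q < 1 \<and> (\<forall>k. norm (X k - l) \<le> C * q ^ k))"

end

theory Submission
  imports Defs
begin

text \<open>
  Since \<open>1 / (2 * \<eta>) > L\<close>, one step does at least as well as minimising the quadratic
  model \<open>f Y + G \<bullet> (W - Y) + (norm (W - Y))\<^sup>2 / (2 * \<eta>)\<close>, \<open>G = grad Y\<close>, over all \<open>W\<close> of
  rank at most \<open>r\<close>. Let \<open>P\<close> and \<open>Q\<close> be the orthogonal projectors onto the column and row
  space of \<open>Y\<close>. The competitors \<open>W = P ** (Y - \<eta> G)\<close> and \<open>W = (Y - \<eta> G) ** Q\<close> have rank at
  most \<open>r\<close>, so \<open>f\<close> decreases by \<open>\<eta> / 2\<close> times the larger of \<open>(norm (P ** G))\<^sup>2\<close> and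
  \<open>(norm (G ** Q))\<^sup>2\<close>.

  To bound these from below, pair \<open>G\<close> with \<open>D = Y - Xs\<close>. Strong convexity makes \<open>G \<bullet> D\<close> at
  least \<open>\<Delta> + \<mu> / 2 * (norm D)\<^sup>2\<close>, where \<open>\<Delta> = f Y - f Xs\<close>. The part of \<open>D\<close> that neither
  \<open>P\<close> nor \<open>Q\<close> sees is \<open>(1 - P) Xs (1 - Q)\<close>, up to sign; it is quadratically small, of norm at most
  \<open>(norm D)\<^sup>2 / \<sigma>\<close> with \<open>\<sigma>\<close> the smallest nonzero singular value of \<open>Xs\<close>. By the
  initialisation bound, its inner product with \<open>G\<close> is at most \<open>0.3 * \<Delta>\<close>. No lower
  bound on the rank or on the singular values of \<open>Y\<close> is required.
\<close>

subsection \<open>The smallest nonzero singular value\<close>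

text \<open>
  Right multiplication of the characteristic matrix of \<open>B\<close> by \<open>P\<close> exposes the factor
  \<open>x - e j\<close> in every eigenvector column, so \<open>B\<close> need not be diagonalised.
\<close>

lemma charpoly_dvd_prod_eigenvalues:
  fixes B P :: "real^'n^'n" and e :: "'n \<Rightarrow> real"
  assumes eig: "\<And>j. j \<in> J \<Longrightarrow> B *v column j P = e j *\<^sub>R column j P"
    and det: "det P \<noteq> 0"
  shows "(\<Prod>j\<in>J. [:- e j, 1:]) dvd charpoly B"
proof -
  define M where "M = (\<chi> i j. (if i = j then [:0, 1:] else 0) - [:B $ i $ j:])"
  define C :: "real poly^'n^'n" where "C = (\<chi> i j. [:P $ i $ j:])"
  define c where "c j = (if j \<in> J then [:- e j, 1:] else 1)" for j
  define a where "a j = (if j \<in> J then row j (transpose C) else row j (transpose (M ** C)))" for j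
  have MC: "(M ** C) $ i $ j = [:0, 1:] * [:P $ i $ j:] - [:(B *v column j P) $ i:]" for i j
  proof -
    have sum_const: "(\<Sum>k\<in>K. [:g k:]) = [:\<Sum>k\<in>K. g k:]" for g :: "'n \<Rightarrow> real" and K
      by (induction K rule: infinite_finite_induct) auto
    have "(M ** C) $ i $ j = (\<Sum>k\<in>UNIV. (if i = k then [:0, 1:] * [:P $ k $ j:] else 0)) - (\<Sum>k\<in>UNIV. [:B $ i $ k * P $ k $ j:])"
      unfolding matrix_matrix_mult_def M_def C_def sum_subtractf[symmetric]
      by (auto simp: smult_diff_right mult.commute intro!: sum.cong)
    then show ?thesis
      by (simp add: sum_const matrix_vector_mult_def column_def)
  qed
  have entry: "(M ** C) $ i $ j = [:- e j, 1:] * C $ i $ j" if "j \<in> J" for i j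
    unfolding MC eig[OF that] by (simp add: C_def column_def)
  \<comment> \<open>Determinants release scalar factors row by row, hence the transpose: the rows
    indexed by \<open>J\<close> give up their linear factors.\<close>
  have "transpose (M ** C) = (\<chi> j. c j *s a j)"
    by (auto simp: vec_eq_iff transpose_def c_def a_def row_def entry)
  then have "det M * det C = prod c UNIV * det (\<chi> j. a j)"
    by (metis det_mul det_rows_mul det_transpose)
  moreover have "prod c UNIV = (\<Prod>j\<in>J. [:- e j, 1:])"
    unfolding c_def by (simp add: prod.If_cases)
  ultimately have dvd: "(\<Prod>j\<in>J. [:- e j, 1:]) dvd det M * det C"
    by simp
  have "det C = [:det P:]"
  proof -
    have sum_const: "(\<Sum>k\<in>K. [:g k:]) = [:\<Sum>k\<in>K. g k:]" for g :: "('n \<Rightarrow> 'n) \<Rightarrow> real" and K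
      by (induction K rule: infinite_finite_induct) auto
    have prod_const: "(\<Prod>k\<in>K. [:g k:]) = [:\<Prod>k\<in>K. g k:]" for g :: "'n \<Rightarrow> real" and K
      by (induction K rule: infinite_finite_induct) (auto simp: one_pCons)
    show ?thesis
      unfolding det_def C_def by (simp add: prod_const of_int_poly mult.commute flip: sum_const)
  qed
  \<comment> \<open>\<open>det C\<close> is a nonzero constant polynomial, so it can be cancelled
    from the divisibility.\<close>
  then have "is_unit (det C)"
    using det by (simp add: is_unit_const_poly_iff dvd_field_iff)
  then have "(\<Prod>j\<in>J. [:- e j, 1:]) dvd det M"
    using dvd by (simp add: dvd_mult_unit_iff)
  then show ?thesis
    by (simp add: charpoly_def M_def)
qed

text \<open>Caps the number of roots, and with it the length of the list of singular values.\<close>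

lemma degree_charpoly_le: "degree (charpoly (B :: real^'n^'n)) \<le> CARD('n)"
proof -
  define M where "M = (\<chi> i j. (if i = j then [:0, 1:] else 0) - [:B $ i $ j:])"
  have deg: "degree (M $ i $ j) \<le> 1" for i j
    unfolding M_def by (auto intro!: degree_diff_le)
  have "degree (of_int (sign p) * (\<Prod>i\<in>UNIV. M $ i $ p i)) \<le> CARD('n)" for p :: "'n \<Rightarrow> 'n"
  proof -
    have "degree (of_int (sign p) * (\<Prod>i\<in>UNIV. M $ i $ p i)) \<le> degree (\<Prod>i\<in>UNIV. M $ i $ p i)"
      by (metis degree_mult_le degree_of_int add_0)
    also have "\<dots> \<le> (\<Sum>i\<in>UNIV. degree (M $ i $ p i))"
      using degree_prod_sum_le[of "UNIV :: 'n set" "\<lambda>i. M $ i $ p i"] by (simp add: o_def)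
    also have "\<dots> \<le> (\<Sum>i\<in>(UNIV :: 'n set). 1)"
      by (intro sum_mono deg)
    finally show ?thesis by simp
  qed
  then show ?thesis
    unfolding charpoly_def M_def[symmetric] det_def by (intro degree_sum_le) auto
qed

text \<open>A basis extending \<open>S\<close> supplies the columns of an invertible
  \<open>P\<close>. Each vector of \<open>S\<close> then brings its own linear factor, so a repeated
  eigenvalue is counted once per vector.\<close>

lemma eigenvalue_count_charpoly:
  fixes B :: "real^'n^'n"
  assumes indep: "independent S"
    and eig: "\<And>v. v \<in> S \<Longrightarrow> \<exists>t\<le>l. B *v v = t *\<^sub>R v"
    and nz: "charpoly B \<noteq> 0"
  shows "card S \<le> size (filter_mset (\<lambda>t. t \<le> l) (proots (charpoly B)))"
proof -
  obtain T where "S \<subseteq> T" "independent T" "UNIV \<subseteq> span T"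
    using maximal_independent_subset_extend[OF subset_UNIV indep] .
  then have T: "S \<subseteq> T" "independent T" "span T = (UNIV :: (real^'n) set)"
    by auto
  have "finite T" and cardT: "card T = CARD('n)"
    using T independent_bound[of T] dim_eq_card_independent[of T] dim_span[of T] by auto
  then obtain c where c: "bij_betw c (UNIV :: 'n set) T"
    using finite_same_card_bij[of "UNIV :: 'n set" T] by auto
  define P where "P = (\<chi> i j. c j $ i)"
  have col: "column j P = c j" for j
    by (simp add: column_def P_def vec_eq_iff)
  have "columns P = T"
    using c by (auto simp: columns_def col bij_betw_def)
  then have "det P \<noteq> 0"
    using T(3) cardT dim_eq_card_independent[OF T(2)] by (simp add: det_eq_0_rank column_rank_def)
  define J where "J = {j. c j \<in> S}"
  have bijJ: "bij_betw c J S"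
    using c T(1) unfolding J_def bij_betw_def by (auto simp: inj_on_def)
  obtain t where t: "\<And>v. v \<in> S \<Longrightarrow> t v \<le> l" "\<And>v. v \<in> S \<Longrightarrow> B *v v = t v *\<^sub>R v"
    using eig by metis
  have "(\<Prod>j\<in>J. [:- t (c j), 1:]) dvd charpoly B"
    by (rule charpoly_dvd_prod_eigenvalues[OF _ \<open>det P \<noteq> 0\<close>]) (simp add: col J_def t)
  then obtain q where q: "charpoly B = (\<Prod>j\<in>J. [:- t (c j), 1:]) * q"
    by (auto elim: dvdE)
  then have "proots (charpoly B) = (\<Sum>j\<in>J. {#t (c j)#}) + proots q"
    using nz by (simp add: proots_mult proots_prod)
  \<comment> \<open>All roots contributed by \<open>S\<close> are at most \<open>l\<close>, so
    filtering keeps every one of them.\<close>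
  moreover have "filter_mset (\<lambda>t. t \<le> l) (\<Sum>j\<in>J. {#t (c j)#}) = (\<Sum>j\<in>J. {#t (c j)#})"
    using t(1) by (auto simp: filter_mset_eq_conv set_mset_sum J_def)
  ultimately have "size (\<Sum>j\<in>J. {#t (c j)#}) \<le> size (filter_mset (\<lambda>t. t \<le> l) (proots (charpoly B)))"
    by simp
  moreover have "size (\<Sum>j\<in>J. {#t (c j)#}) = card S"
    using bij_betw_same_card[OF bijJ] by simp
  ultimately show ?thesis by simp
qed

text \<open>The list is in decreasing order. If entry number \<open>rs\<close> exceeded
  \<open>sqrt l\<close>, so would all earlier ones, leaving at most \<open>CARD('n) - rs\<close>
  entries for the roots up to \<open>l\<close>, fewer than were counted.\<close>

lemma singular_value_le_of_count:
  fixes A :: "real^'n^'n"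
  assumes count: "CARD('n) < rs + size (filter_mset (\<lambda>t. t \<le> l) (proots (charpoly (transpose A ** A))))"
    and "0 \<le> l"
  shows "singular_value rs A \<le> sqrt l"
proof (rule ccontr)
  assume "\<not> ?thesis"
  then have gt: "singular_value rs A > sqrt l" by simp
  define xs where "xs = singular_values A"
  define p where "p = charpoly (transpose A ** A)"
  have mset: "mset xs = image_mset sqrt (proots p)"
    by (simp add: xs_def singular_values_def p_def)
  have sorted: "sorted (rev xs)"
    by (simp add: xs_def singular_values_def)
  \<comment> \<open>Out of range the value is 0, which cannot exceed \<open>sqrt l\<close>; so
    \<open>rs\<close> is a valid index.\<close>
  have rs: "1 \<le> rs" "rs \<le> length xs" "xs ! (rs - 1) > sqrt l"
    using gt \<open>0 \<le> l\<close> unfolding singular_value_def xs_def[symmetric]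
    by (auto split: if_splits)
  have big: "\<not> x \<le> sqrt l" if "x \<in> set (take rs xs)" for x
  proof -
    obtain i where "i < length (take rs xs)" "take rs xs ! i = x"
      using \<open>x \<in> set (take rs xs)\<close> by (metis in_set_conv_nth)
    then have i: "i < rs" "i < length xs" "x = xs ! i"
      by auto
    then have "xs ! (rs - 1) \<le> xs ! i"
      using sorted rs by (intro sorted_rev_nth_mono) auto
    then show ?thesis using rs(3) i(3) by simp
  qed
  have "length (filter (\<lambda>x. x \<le> sqrt l) xs) = length (filter (\<lambda>x. x \<le> sqrt l) (drop rs xs))"
    using big by (subst append_take_drop_id[of rs xs, symmetric], subst filter_append) simp
  also have "\<dots> \<le> length xs - rs"
    by (metis length_drop length_filter_le)
  finally have le: "length (filter (\<lambda>x. x \<le> sqrt l) xs) \<le> length xs - rs" .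
  have "length xs = size (proots p)"
    by (metis mset size_image_mset size_mset)
  also have "\<dots> \<le> CARD('n)"
    unfolding p_def using size_proots_le degree_charpoly_le by (rule order_trans)
  finally have len: "length xs \<le> CARD('n)" .
  have "length (filter (\<lambda>x. x \<le> sqrt l) xs) = size (filter_mset (\<lambda>x. x \<le> sqrt l) (mset xs))"
    by (metis mset_filter size_mset)
  also have "\<dots> = size (filter_mset (\<lambda>t. t \<le> l) (proots p))"
    by (simp add: mset filter_mset_image_mset)
  finally show False
    using le len rs(2) count unfolding p_def by linarith
qed

text \<open>First-order condition for the Rayleigh quotient on the row space. The residual
  \<open>w\<close> lies in the row space, so moving from \<open>v\<close> along \<open>w\<close> is
  admissible. This gives a quadratic in \<open>t\<close> with linear coefficient
  \<open>2 * (w \<bullet> w)\<close> and no constant term; being nonnegative for both signs of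
  \<open>t\<close>, it forces \<open>w = 0\<close>.\<close>

lemma rayleigh_minimizer_is_eigenvector:
  fixes A :: "real^'n^'m"
  assumes v: "v \<in> span (rows A)" "norm v = 1"
    and min: "\<And>x. x \<in> span (rows A) \<Longrightarrow> l * (norm x)\<^sup>2 \<le> (norm (A *v x))\<^sup>2"
    and eq: "(norm (A *v v))\<^sup>2 = l"
  shows "(transpose A ** A) *v v = l *\<^sub>R v"
proof -
  define w where "w = (transpose A ** A) *v v - l *\<^sub>R v"
  have "(transpose A ** A) *v v \<in> span (rows A)"
    by (metis matrix_vector_mul_assoc matrix_vector_mult_in_columnspace columns_transpose)
  then have w: "w \<in> span (rows A)"
    unfolding w_def using v(1) by (intro span_diff span_scale)
  have adj: "((transpose A ** A) *v v) \<bullet> y = (A *v v) \<bullet> (A *v y)" for y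
    by (metis dot_lmul_matrix matrix_vector_mul_assoc transpose_matrix_vector)
  have ww: "w \<bullet> w = (A *v v) \<bullet> (A *v w) - l * (v \<bullet> w)"
    by (subst w_def) (simp add: inner_diff_left adj)
  define q where "q = (norm (A *v w))\<^sup>2 - l * (norm w)\<^sup>2"
  have nonneg: "0 \<le> 2 * t * (w \<bullet> w) + t\<^sup>2 * q" for t
  proof -
    have "v + t *\<^sub>R w \<in> span (rows A)"
      using v(1) w by (intro span_add span_scale)
    from min[OF this] have le: "l * (norm (v + t *\<^sub>R w))\<^sup>2 \<le> (norm (A *v v + t *\<^sub>R (A *v w)))\<^sup>2"
      by (simp add: matrix_vector_right_distrib matrix_vector_mult_scaleR)
    have expand: "(norm (a + t *\<^sub>R b))\<^sup>2 = (norm a)\<^sup>2 + 2 * t * (a \<bullet> b) + t\<^sup>2 * (norm b)\<^sup>2" for a b :: "real^'k"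
      unfolding power2_norm_eq_inner by (simp add: inner_add inner_commute algebra_simps power2_eq_square)
    show ?thesis
      using le v(2) eq
      unfolding ww q_def expand[of v w] expand[of "A *v v" "A *v w"]
      by (simp add: algebra_simps)
  qed
  have "w \<bullet> w = 0"
  proof (rule ccontr)
    assume "w \<bullet> w \<noteq> 0"
    then have pos: "w \<bullet> w > 0" by simp
    \<comment> \<open>The size of \<open>t\<close> keeps the quadratic term within half of the
      negative linear one; adding 1 keeps the denominator positive.\<close>
    define t where "t = - (w \<bullet> w) / (\<bar>q\<bar> + 1)"
    have "t\<^sup>2 * q \<le> t\<^sup>2 * (\<bar>q\<bar> + 1)"
      by (intro mult_left_mono) auto
    also have "\<dots> = - t * (w \<bullet> w)"
    proof -
      have "t * (\<bar>q\<bar> + 1) = - (w \<bullet> w)"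
        unfolding t_def by simp
      then show ?thesis
        by (simp add: power2_eq_square mult.assoc)
    qed
    finally have "2 * t * (w \<bullet> w) + t\<^sup>2 * q \<le> t * (w \<bullet> w)" by linarith
    moreover have "t * (w \<bullet> w) < 0"
      using pos unfolding t_def by (simp add: field_simps add_nonneg_pos mult_pos_pos)
    ultimately show False using nonneg[of t] by linarith
  qed
  then show ?thesis by (simp add: w_def)
qed

text \<open>A root has an eigenvector \<open>x\<close>, and pairing the eigenvalue equation with
  \<open>x\<close> makes \<open>t\<close> a quotient of squared norms.\<close>

lemma charpoly_gram_root_nonneg:
  fixes A :: "real^'n^'n"
  assumes "poly (charpoly (transpose A ** A)) t = 0"
  shows "0 \<le> t"
proof -
  have "poly (charpoly (transpose A ** A)) t = det (t *\<^sub>R mat 1 - transpose A ** A)"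
    unfolding charpoly_def det_def
    by (simp add: poly_sum poly_prod mat_def if_distrib[of "\<lambda>p. poly p _"] cong: if_cong)
       (auto intro!: sum.cong prod.cong)
  then have "det (t *\<^sub>R mat 1 - transpose A ** A) = 0"
    using assms by simp
  then have "\<not> (\<exists>C. C ** (t *\<^sub>R mat 1 - transpose A ** A) = mat 1)"
    using invertible_det_nz invertible_left_inverse by blast
  then obtain x where x: "x \<noteq> 0" "(t *\<^sub>R mat 1 - transpose A ** A) *v x = 0"
    unfolding matrix_left_invertible_ker by auto
  moreover have "t *\<^sub>R mat 1 *v x = t *\<^sub>R x"
    by (metis matrix_vector_mul_lid scaleR_matrix_vector_assoc)
  ultimately have "(transpose A ** A) *v x = t *\<^sub>R x"
    by (simp add: matrix_vector_mult_diff_rdistrib)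
  then have "(A *v x) \<bullet> (A *v x) = t * (x \<bullet> x)"
    by (metis dot_lmul_matrix inner_scaleR_left matrix_vector_mul_assoc transpose_matrix_vector)
  then have "0 \<le> t * (x \<bullet> x)"
    by (metis inner_ge_zero)
  then show ?thesis
    using x(1) by (metis inner_gt_zero_iff zero_le_mult_iff not_le)
qed

text \<open>The zero polynomial would have the negative root \<open>-1\<close>.\<close>

lemma charpoly_gram_nonzero: "charpoly (transpose A ** A) \<noteq> 0" for A :: "real^'n^'n"
  using charpoly_gram_root_nonneg[of A "-1"] by auto

lemma singular_value_nonneg: "0 \<le> singular_value i A"
proof -
  have "0 \<le> x" if "x \<in> set (singular_values A)" for x
    using that charpoly_gram_root_nonneg[of A] charpoly_gram_nonzero[of A]
    by (auto simp: singular_values_def)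
  then show ?thesis
    using nth_mem[of "i - 1" "singular_values A"] by (auto simp: singular_value_def)
qed

text \<open>The least stretching of unit vectors in the row space is attained at some
  \<open>v\<close>, an eigenvector of the Gram matrix for the square \<open>l\<close> of that
  minimum. With a basis of the kernel this yields enough independent eigenvectors with eigenvalue at
  most \<open>l\<close> to push singular value number \<open>rank A\<close> down to
  \<open>sqrt l\<close>.\<close>

lemma singular_value_rank_le:
  fixes A :: "real^'n^'n"
  assumes y: "y \<in> span (rows A)"
  shows "singular_value (rank A) A * norm y \<le> norm (A *v y)"
proof (cases "y = 0")
  case False
  define S where "S = span (rows A) \<inter> sphere 0 1"
  have "compact S"
    unfolding S_def by (simp add: closed_Int_compact closed_subspace)
  moreover have "(1 / norm y) *\<^sub>R y \<in> S"
    using False y by (simp add: S_def span_scale)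
  then have "S \<noteq> {}"
    by blast
  moreover have "continuous_on S (\<lambda>x. norm (A *v x))"
    by (intro continuous_on_norm linear_continuous_on matrix_vector_mul_bounded_linear)
  ultimately obtain v where v: "v \<in> S" "\<And>x. x \<in> S \<Longrightarrow> norm (A *v v) \<le> norm (A *v x)"
    using continuous_attains_inf[of S "\<lambda>x. norm (A *v x)"] by auto
  then have v': "v \<in> span (rows A)" "norm v = 1"
    by (auto simp: S_def)
  have min: "norm (A *v v) * norm x \<le> norm (A *v x)" if "x \<in> span (rows A)" for x
  proof (cases "x = 0")
    case False
    then have "(1 / norm x) *\<^sub>R x \<in> S"
      using that by (simp add: S_def span_scale)
    from v(2)[OF this] show ?thesis
      using False by (simp add: matrix_vector_mult_scaleR field_simps)
  qed simp
  define l where "l = (norm (A *v v))\<^sup>2"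
  have eigv: "(transpose A ** A) *v v = l *\<^sub>R v"
  proof (rule rayleigh_minimizer_is_eigenvector[OF v'])
    show "l * (norm x)\<^sup>2 \<le> (norm (A *v x))\<^sup>2" if "x \<in> span (rows A)" for x
      using power_mono[OF min[OF that], of 2] by (simp add: l_def power_mult_distrib)
  qed (simp add: l_def)
  define K where "K = {x. A *v x = 0}"
  \<comment> \<open>As the orthogonal complement of the row space, the kernel has dimension
    \<open>CARD('n) - rank A\<close>.\<close>
  have K: "K = {x \<in> UNIV. \<forall>z\<in>span (rows A). orthogonal z x}"
  proof (intro equalityI subsetI)
    fix x assume "x \<in> K"
    then show "x \<in> {x \<in> UNIV. \<forall>z\<in>span (rows A). orthogonal z x}"
      using orthogonal_nullspace_rowspace[of A x] by (auto simp: K_def orthogonal_commute)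
  next
    fix x assume "x \<in> {x \<in> UNIV. \<forall>z\<in>span (rows A). orthogonal z x}"
    then have "orthogonal (A $ i) x" for i
      by (auto intro!: span_base simp: rows_def row_def vec_lambda_eta)
    then show "x \<in> K"
      by (simp add: K_def vec_eq_iff matrix_vector_mul_component orthogonal_def)
  qed
  have dimK: "dim K + rank A = CARD('n)"
    using dim_subspace_orthogonal_to_vectors[of "span (rows A)" UNIV]
    by (simp add: K row_rank_def)
  have "subspace K"
    unfolding K using subspace_orthogonal_to_vectors[of "span (rows A)"] by simp
  obtain T where T: "T \<subseteq> K" "independent T" "K \<subseteq> span T" "card T = dim K"
    using basis_exists[of K] .
  have "span T = K"
    using T \<open>subspace K\<close> by (simp add: span_minimal subset_antisym)
  have "v \<notin> K"
    using nullspace_inter_rowspace[of A v] v' by (auto simp: K_def)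
  then have "v \<notin> T"
    using T(1) by blast
  with \<open>v \<notin> K\<close> have "independent (insert v T)" and "card (insert v T) = Suc (dim K)"
    using T \<open>span T = K\<close> independent_imp_finite[of T] by (auto simp: independent_insert)
  moreover have "\<exists>t\<le>l. (transpose A ** A) *v u = t *\<^sub>R u" if "u \<in> insert v T" for u
  proof (cases "u = v")
    case False
    then have "A *v u = 0"
      using that T(1) by (auto simp: K_def)
    then have "(transpose A ** A) *v u = 0 *\<^sub>R u"
      by (metis matrix_vector_mul_assoc matrix_vector_mult_0_right scaleR_zero_left)
    then show ?thesis
      by (auto simp: l_def intro!: exI[of _ 0])
  qed (use eigv in auto)
  ultimately have "card (insert v T) \<le> size (filter_mset (\<lambda>t. t \<le> l) (proots (charpoly (transpose A ** A))))"
    by (intro eigenvalue_count_charpoly charpoly_gram_nonzero)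
  \<comment> \<open>The extra vector \<open>v\<close> makes the count exceed
    \<open>CARD('n) - rank A\<close> by one, which gives the strict inequality required.\<close>
  then have "singular_value (rank A) A \<le> sqrt l"
    using dimK \<open>card (insert v T) = Suc (dim K)\<close> by (intro singular_value_le_of_count) (auto simp: l_def)
  then have "singular_value (rank A) A * norm y \<le> norm (A *v v) * norm y"
    by (intro mult_right_mono) (auto simp: l_def)
  also have "\<dots> \<le> norm (A *v y)"
    using min y .
  finally show ?thesis .
qed simp

subsection \<open>Frobenius geometry and rank\<close>

lemma inner_matrix_eq: "A \<bullet> B = (\<Sum>i\<in>UNIV. \<Sum>j\<in>UNIV. A $ i $ j * B $ i $ j)" for A B :: "real^'n^'m"
  by (simp add: inner_vec_def)

lemma inner_transpose: "transpose A \<bullet> transpose B = A \<bullet> B" for A B :: "real^'n^'m"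
  unfolding inner_matrix_eq by (subst sum.swap) (simp add: transpose_def)

lemma norm_transpose: "norm (transpose A) = norm A" for A :: "real^'n^'m"
  by (simp add: norm_eq_sqrt_inner inner_transpose)

lemma transpose_diff: "transpose (A - B) = transpose A - transpose B" for A B :: "real^'n^'m"
  by (simp add: transpose_def vec_eq_iff)

lemma inner_matrix_mult_left: "(P ** A) \<bullet> B = A \<bullet> (transpose P ** B)"
  for P :: "real^'k^'m" and A :: "real^'n^'k" and B :: "real^'n^'m"
proof -
  have "(P ** A) \<bullet> B = (\<Sum>i\<in>UNIV. \<Sum>j\<in>UNIV. \<Sum>k\<in>UNIV. P $ i $ k * A $ k $ j * B $ i $ j)"
    by (simp add: inner_matrix_eq matrix_matrix_mult_def sum_distrib_right)
  also have "\<dots> = (\<Sum>i\<in>UNIV. \<Sum>k\<in>UNIV. \<Sum>j\<in>UNIV. P $ i $ k * A $ k $ j * B $ i $ j)"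
    by (intro sum.cong refl sum.swap)
  also have "\<dots> = (\<Sum>k\<in>UNIV. \<Sum>i\<in>UNIV. \<Sum>j\<in>UNIV. P $ i $ k * A $ k $ j * B $ i $ j)"
    by (rule sum.swap)
  also have "\<dots> = (\<Sum>k\<in>UNIV. \<Sum>j\<in>UNIV. \<Sum>i\<in>UNIV. P $ i $ k * A $ k $ j * B $ i $ j)"
    by (intro sum.cong refl sum.swap)
  also have "\<dots> = A \<bullet> (transpose P ** B)"
    by (simp add: inner_matrix_eq matrix_matrix_mult_def transpose_def sum_distrib_left mult_ac)
  finally show ?thesis .
qed

lemma inner_matrix_mult_right: "(A ** Q) \<bullet> B = A \<bullet> (B ** transpose Q)"
  for Q :: "real^'n^'k" and A :: "real^'k^'m" and B :: "real^'n^'m"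
proof -
  have "(A ** Q) \<bullet> B = (transpose Q ** transpose A) \<bullet> transpose B"
    by (metis inner_transpose matrix_transpose_mul)
  also have "\<dots> = transpose A \<bullet> (Q ** transpose B)"
    by (simp only: inner_matrix_mult_left transpose_transpose)
  also have "\<dots> = A \<bullet> (B ** transpose Q)"
    by (metis inner_transpose matrix_transpose_mul transpose_transpose)
  finally show ?thesis .
qed

lemma matrix_mult_diff_distrib: "P ** (A - B) = P ** A - P ** B"
  for P :: "'a::ring_1^'k^'m"
  by (simp add: matrix_matrix_mult_def vec_eq_iff right_diff_distrib sum_subtractf)

lemma matrix_mult_diff_rdistrib: "(A - B) ** P = A ** P - B ** P"
  for P :: "'a::ring_1^'n^'k"
  by (simp add: matrix_matrix_mult_def vec_eq_iff left_diff_distrib sum_subtractf)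

lemma matrix_mult_minus_left: "(- A) ** P = - (A ** P)"
  for P :: "'a::ring_1^'n^'k"
  by (simp add: matrix_matrix_mult_def vec_eq_iff sum_negf)

lemma matrix_mult_scaleR_right: "P ** (c *\<^sub>R A) = c *\<^sub>R (P ** A)"
  for P :: "real^'k^'m"
  by (simp add: matrix_matrix_mult_def vec_eq_iff sum_distrib_left mult_ac)

lemma matrix_mult_scaleR_left: "(c *\<^sub>R A) ** P = c *\<^sub>R (A ** P)"
  for P :: "real^'n^'k"
  by (simp add: matrix_matrix_mult_def vec_eq_iff sum_distrib_left mult_ac)

lemma norm_matrix_vector_mult_le: "norm (M *v x) \<le> norm M * norm x" for M :: "real^'n^'m"
proof (rule power2_le_imp_le)
  have "(norm (M *v x))\<^sup>2 = (\<Sum>i\<in>UNIV. (M $ i \<bullet> x)\<^sup>2)"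
    by (simp add: power2_norm_eq_inner inner_vec_def[of "M *v x"] matrix_vector_mul_component)
       (simp add: power2_eq_square)
  also have "\<dots> \<le> (\<Sum>i\<in>UNIV. (M $ i \<bullet> M $ i) * (x \<bullet> x))"
    by (intro sum_mono Cauchy_Schwarz_ineq)
  also have "\<dots> = (norm M * norm x)\<^sup>2"
    by (simp add: power_mult_distrib power2_norm_eq_inner inner_vec_def[of M] sum_distrib_right)
  finally show "(norm (M *v x))\<^sup>2 \<le> (norm M * norm x)\<^sup>2" .
qed simp

text \<open>Lets a Frobenius norm estimate be proved one column at a time.\<close>

lemma norm_eq_sum_columns: "(norm M)\<^sup>2 = (\<Sum>j\<in>UNIV. (norm (M *v axis j 1))\<^sup>2)" for M :: "real^'n^'m"
proof -
  have "transpose M $ j = M *v axis j 1" for j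
    by (simp add: matrix_vector_mult_basis transpose_def column_def vec_eq_iff)
  then show ?thesis
    unfolding norm_transpose[of M, symmetric] power2_norm_eq_inner inner_vec_def[of "transpose M"]
    by simp
qed

lemma rank_add_le: "rank (A + B) \<le> rank A + rank B" for A B :: "real^'n^'m"
proof -
  let ?R = "\<lambda>A::real^'n^'m. range (\<lambda>x. A *v x)"
  have sub: "subspace (?R A)" for A :: "real^'n^'m"
    using linear_subspace_image[of "(*v) A" UNIV] by simp
  have "?R (A + B) \<subseteq> {x + y |x y. x \<in> ?R A \<and> y \<in> ?R B}"
    by (auto simp: matrix_vector_mult_add_rdistrib)
  then have "rank (A + B) \<le> dim {x + y |x y. x \<in> ?R A \<and> y \<in> ?R B}"
    unfolding rank_dim_range by (rule dim_subset)
  also have "\<dots> \<le> rank A + rank B"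
    using dim_sums_Int[OF sub[of A] sub[of B]] by (simp add: rank_dim_range)
  finally show ?thesis .
qed

lemma rank_scaleR_le: "rank (c *\<^sub>R A) \<le> rank A" for A :: "real^'n^'m"
  using rank_mul_le_right[of "c *\<^sub>R mat 1" A] by (simp add: matrix_mult_scaleR_left)

lemma rank_diff_le: "rank (A - B) \<le> rank A + rank B" for A B :: "real^'n^'m"
  using rank_add_le[of A "(-1) *\<^sub>R B"] rank_scaleR_le[of "-1" B] by simp

section \<open>Orthogonal projectors onto column and row spaces\<close>

definition orthogonal_projector :: "real^'n^'n \<Rightarrow> bool" where
  "orthogonal_projector P \<longleftrightarrow> transpose P = P \<and> P ** P = P"

text \<open>The rank bound on \<open>P\<close> is what makes projected gradient steps admissible
  competitors.\<close>

lemma ex_column_space_projector: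
  fixes X :: "real^'n^'m"
  obtains P where "orthogonal_projector P" "P ** X = X" "rank P \<le> rank X"
proof -
  obtain B where B: "B \<subseteq> span (columns X)" "pairwise orthogonal B" "\<And>x. x \<in> B \<Longrightarrow> norm x = 1"
    "independent B" "card B = dim (span (columns X))" "span B = span (columns X)"
    using orthonormal_basis_subspace[OF subspace_span] by metis
  have fin: "finite B"
    using B(4) by (rule independent_imp_finite)
  \<comment> \<open>The sum of the outer products of the orthonormal basis vectors with
    themselves.\<close>
  define P :: "real^'m^'m" where "P = (\<chi> i j. \<Sum>b\<in>B. b $ i * b $ j)"
  have Pv: "P *v x = (\<Sum>b\<in>B. (b \<bullet> x) *\<^sub>R b)" for x
  proof -
    have "(P *v x) $ i = (\<Sum>b\<in>B. (b \<bullet> x) *\<^sub>R b) $ i" for i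
    proof -
      have "(P *v x) $ i = (\<Sum>j\<in>UNIV. \<Sum>b\<in>B. b $ i * b $ j * x $ j)"
        by (simp add: P_def matrix_vector_mult_def sum_distrib_right)
      also have "\<dots> = (\<Sum>b\<in>B. \<Sum>j\<in>UNIV. b $ i * b $ j * x $ j)"
        by (rule sum.swap)
      also have "\<dots> = (\<Sum>b\<in>B. (b \<bullet> x) *\<^sub>R b) $ i"
        by (simp add: inner_vec_def sum_distrib_left mult_ac)
      finally show ?thesis .
    qed
    then show ?thesis by (simp add: vec_eq_iff)
  qed
  have base: "P *v b = b" if "b \<in> B" for b
  proof -
    have "(c \<bullet> b) *\<^sub>R c = (if c = b then b else 0)" if "c \<in> B" for c
      using B(2) B(3)[OF \<open>b \<in> B\<close>] that \<open>b \<in> B\<close>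
      by (auto simp: pairwise_def orthogonal_def norm_eq_1)
    then show ?thesis
      unfolding Pv using fin that by (simp cong: sum.cong)
  qed
  have fixed: "P *v x = x" if "x \<in> span (columns X)" for x
    using that unfolding B(6)[symmetric]
  proof (induction rule: span_induct)
    case base
    show ?case
      by (auto simp: subspace_def matrix_vector_right_distrib matrix_vector_mult_scaleR)
  qed (rule base)
  have ran: "P *v x \<in> span (columns X)" for x
    unfolding Pv B(6)[symmetric] by (intro span_sum span_scale span_base)
  show thesis
  proof
    show "orthogonal_projector P"
      unfolding orthogonal_projector_def
    proof
      show "transpose P = P"
        by (simp add: P_def transpose_def mult.commute)
      show "P ** P = P"
        by (simp add: matrix_eq fixed ran flip: matrix_vector_mul_assoc)
    qed
    show "P ** X = X"
      by (simp add: matrix_eq fixed matrix_vector_mult_in_columnspace flip: matrix_vector_mul_assoc)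
    have "rank P \<le> dim (span (columns X))"
      unfolding rank_dim_range using ran by (intro dim_subset) auto
    then show "rank P \<le> rank X"
      by (simp add: column_rank_def)
  qed
qed

lemma ex_row_space_projector:
  fixes X :: "real^'n^'m"
  obtains Q where "orthogonal_projector Q" "X ** Q = X" "rank Q \<le> rank X"
proof -
  obtain Q where Q: "orthogonal_projector Q" "Q ** transpose X = transpose X" "rank Q \<le> rank (transpose X)"
    using ex_column_space_projector .
  show thesis
  proof
    show "X ** Q = X"
      using Q(1,2) unfolding orthogonal_projector_def
      by (metis matrix_transpose_mul transpose_transpose)
  qed (use Q in \<open>auto simp: rank_transpose\<close>)
qed

lemma orthogonal_projector_inner:
  assumes "orthogonal_projector P"
  shows "(P ** A) \<bullet> (P ** B) = A \<bullet> (P ** B)"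
  using assms unfolding orthogonal_projector_def
  by (simp add: inner_matrix_mult_left matrix_mul_assoc)

lemma orthogonal_projector_inner_right:
  assumes "orthogonal_projector Q"
  shows "(A ** Q) \<bullet> (B ** Q) = A \<bullet> (B ** Q)"
  using assms unfolding orthogonal_projector_def
  by (simp add: inner_matrix_mult_right flip: matrix_mul_assoc)

lemma orthogonal_projector_Pythagoras:
  assumes "orthogonal_projector P"
  shows "(norm A)\<^sup>2 = (norm (P ** A))\<^sup>2 + (norm (A - P ** A))\<^sup>2"
proof -
  have "(P ** A) \<bullet> (A - P ** A) = 0"
    using orthogonal_projector_inner[OF assms, of A A] by (simp add: inner_diff_right inner_commute)
  then show ?thesis
    using norm_add_Pythagorean[of "P ** A" "A - P ** A"] by (simp add: orthogonal_def)
qed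

lemma orthogonal_projector_complement_le:
  assumes "orthogonal_projector P"
  shows "norm (A - P ** A) \<le> norm A"
  by (rule power2_le_imp_le) (simp_all add: orthogonal_projector_Pythagoras[OF assms, of A])

lemma orthogonal_projector_complement_right_le:
  assumes "orthogonal_projector Q"
  shows "norm (A - A ** Q) \<le> norm A"
proof -
  have "norm (A - A ** Q) = norm (transpose A - Q ** transpose A)"
  proof -
    have "transpose (A - A ** Q) = transpose A - Q ** transpose A"
      using assms unfolding orthogonal_projector_def
      by (metis matrix_transpose_mul transpose_diff)
    then show ?thesis by (metis norm_transpose)
  qed
  also have "\<dots> \<le> norm A"
    using orthogonal_projector_complement_le[OF assms, of "transpose A"] by (simp add: norm_transpose)
  finally show ?thesis .
qed

text \<open>\<open>A\<close> is bounded below by \<open>s\<close> on its row space, so the two-sided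
  remainder is controlled by the product of the one-sided remainders of \<open>A\<close>. As
  \<open>P\<close> and \<open>Q\<close> fix \<open>X\<close>, those are also remainders of
  \<open>A - X\<close>, whence the square. Keeping \<open>s\<close> as a factor on the left covers
  \<open>s = 0\<close>.\<close>

lemma normal_component_bound:
  fixes A X :: "real^'n^'m"
  assumes P: "orthogonal_projector P" "P ** X = X"
    and Q: "orthogonal_projector Q" "X ** Q = X"
    and s: "0 \<le> s" "\<And>y. y \<in> span (rows A) \<Longrightarrow> s * norm y \<le> norm (A *v y)"
  defines "M \<equiv> A - P ** A"
  shows "s * norm (M - M ** Q) \<le> (norm (X - A))\<^sup>2"
proof -
  define N where "N = M - M ** Q"
  define U where "U = A - A ** Q"
  have col: "s * norm (N *v e) \<le> norm M * norm (U *v e)" for e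
  proof -
    \<comment> \<open>Only the row space component \<open>y\<close> counts: \<open>A\<close>, and
      therefore \<open>M\<close>, annihilates \<open>z\<close>.\<close>
    obtain y z where yz: "y \<in> span (rows A)" "\<And>w. w \<in> span (rows A) \<Longrightarrow> orthogonal z w"
      "e - Q *v e = y + z"
      using orthogonal_subspace_decomp_exists[of "rows A" "e - Q *v e"] by metis
    have "A $ i \<in> rows A" for i
      by (auto simp: rows_def row_def vec_lambda_eta)
    then have "orthogonal (A $ i) z" for i
      using yz(2) span_base orthogonal_commute by blast
    then have Az: "A *v z = 0"
      by (simp add: vec_eq_iff matrix_vector_mul_component orthogonal_def)
    have Mz: "M *v z = 0"
      by (simp add: M_def matrix_vector_mult_diff_rdistrib Az flip: matrix_vector_mul_assoc)
    have "N *v e = M *v (e - Q *v e)"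
      by (simp add: N_def matrix_vector_mult_diff_rdistrib matrix_vector_mult_diff_distrib matrix_vector_mul_assoc)
    then have Ne: "N *v e = M *v y"
      by (simp add: yz(3) matrix_vector_right_distrib Mz)
    have "U *v e = A *v (e - Q *v e)"
      by (simp add: U_def matrix_vector_mult_diff_rdistrib matrix_vector_mult_diff_distrib matrix_vector_mul_assoc)
    then have Ue: "U *v e = A *v y"
      by (simp add: yz(3) matrix_vector_right_distrib Az)
    have "s * norm (N *v e) \<le> s * (norm M * norm y)"
      unfolding Ne using s(1) by (intro mult_left_mono norm_matrix_vector_mult_le)
    also have "\<dots> = norm M * (s * norm y)"
      by simp
    also have "\<dots> \<le> norm M * norm (U *v e)"
      unfolding Ue by (intro mult_left_mono s(2) yz(1)) simp
    finally show ?thesis .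
  qed
  have "s * norm N \<le> norm M * norm U"
  proof (rule power2_le_imp_le)
    have "(s * norm N)\<^sup>2 = (\<Sum>j\<in>UNIV. (s * norm (N *v axis j 1))\<^sup>2)"
      by (simp add: power_mult_distrib norm_eq_sum_columns[of N] sum_distrib_left)
    also have "\<dots> \<le> (\<Sum>j\<in>UNIV. (norm M * norm (U *v axis j 1))\<^sup>2)"
      using s(1) by (intro sum_mono power_mono col) simp
    also have "\<dots> = (norm M * norm U)\<^sup>2"
      by (simp add: power_mult_distrib norm_eq_sum_columns[of U] sum_distrib_left)
    finally show "(s * norm N)\<^sup>2 \<le> (norm M * norm U)\<^sup>2" .
  qed simp
  also have "\<dots> \<le> norm (A - X) * norm (A - X)"
  proof (intro mult_mono)
    have "M = (A - X) - P ** (A - X)"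
      by (simp add: M_def matrix_mult_diff_distrib P(2))
    then show "norm M \<le> norm (A - X)"
      using orthogonal_projector_complement_le[OF P(1), of "A - X"] by simp
    have "U = (A - X) - (A - X) ** Q"
      by (simp add: U_def matrix_mult_diff_rdistrib Q(2))
    then show "norm U \<le> norm (A - X)"
      using orthogonal_projector_complement_right_le[OF Q(1), of "A - X"] by simp
  qed auto
  finally show ?thesis
    by (simp add: N_def power2_eq_square norm_minus_commute)
qed

text \<open>\<open>D\<close> splits into \<open>P ** D\<close>, \<open>M ** Q\<close> and the
  remainder \<open>M - M ** Q\<close>. Against the first two, \<open>G\<close> acts only through
  \<open>P ** G\<close> and \<open>G ** Q\<close>. The factor 2 comes from adding the norms of the
  orthogonal pieces \<open>P ** D\<close> and \<open>M\<close>.\<close>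

lemma inner_tangent_part_bound:
  fixes G D :: "real^'n^'m"
  assumes P: "orthogonal_projector P" and Q: "orthogonal_projector Q"
    and s: "norm (P ** G) \<le> s" "norm (G ** Q) \<le> s"
  defines "M \<equiv> D - P ** D"
  shows "(G \<bullet> D - G \<bullet> (M - M ** Q))\<^sup>2 \<le> 2 * s\<^sup>2 * (norm D)\<^sup>2"
proof -
  have "G \<bullet> D - G \<bullet> (M - M ** Q) = G \<bullet> (P ** D) + G \<bullet> (M ** Q)"
    by (simp add: M_def inner_diff_right)
  also have "G \<bullet> (P ** D) = (P ** G) \<bullet> (P ** D)"
    using orthogonal_projector_inner[OF P] by metis
  also have "G \<bullet> (M ** Q) = (G ** Q) \<bullet> M"
    using Q unfolding orthogonal_projector_def by (simp add: inner_matrix_mult_right)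
  finally have eq: "G \<bullet> D - G \<bullet> (M - M ** Q) = (P ** G) \<bullet> (P ** D) + (G ** Q) \<bullet> M" .
  have "0 \<le> s"
    using s(1) norm_ge_zero order_trans by blast
  have "\<bar>(P ** G) \<bullet> (P ** D)\<bar> \<le> s * norm (P ** D)"
    using Cauchy_Schwarz_ineq2 mult_right_mono[OF s(1) norm_ge_zero] by (rule order_trans)
  moreover have "\<bar>(G ** Q) \<bullet> M\<bar> \<le> s * norm M"
    using Cauchy_Schwarz_ineq2 mult_right_mono[OF s(2) norm_ge_zero] by (rule order_trans)
  ultimately have "\<bar>G \<bullet> D - G \<bullet> (M - M ** Q)\<bar> \<le> s * (norm (P ** D) + norm M)"
    unfolding eq by (simp add: distrib_left)
  then have "(G \<bullet> D - G \<bullet> (M - M ** Q))\<^sup>2 \<le> (s * (norm (P ** D) + norm M))\<^sup>2"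
    by (metis abs_ge_zero power2_abs power_mono)
  also have "\<dots> = s\<^sup>2 * (norm (P ** D) + norm M)\<^sup>2"
    by (rule power_mult_distrib)
  also have "\<dots> \<le> s\<^sup>2 * (2 * ((norm (P ** D))\<^sup>2 + (norm M)\<^sup>2))"
    using sum_squares_bound[of "norm (P ** D)" "norm M"]
    by (intro mult_left_mono) (simp_all add: power2_sum)
  also have "\<dots> = 2 * s\<^sup>2 * (norm D)\<^sup>2"
    using orthogonal_projector_Pythagoras[OF P, of D] by (simp add: M_def)
  finally show ?thesis .
qed

lemma rank_segment_le: "rank (Y + t *\<^sub>R (Z - Y)) \<le> rank Y + rank Z" for Y Z :: "real^'n^'m"
proof -
  have "Y + t *\<^sub>R (Z - Y) = (1 - t) *\<^sub>R Y + t *\<^sub>R Z"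
    by (simp add: algebra_simps)
  then have "rank (Y + t *\<^sub>R (Z - Y)) \<le> rank ((1 - t) *\<^sub>R Y) + rank (t *\<^sub>R Z)"
    by (metis rank_add_le)
  then show ?thesis
    using rank_scaleR_le[of "1 - t" Y] rank_scaleR_le[of t Z] by linarith
qed

subsection \<open>Restricted smoothness and strong convexity\<close>

text \<open>Integrates the slope bound: the parabola minus \<open>g\<close> is nondecreasing.
  \<open>m\<close> may have either sign; strong convexity uses it for the negated function with
  \<open>m = - (\<mu> * (norm E)\<^sup>2)\<close>.\<close>

lemma upper_quadratic_bound:
  fixes g g' :: "real \<Rightarrow> real"
  assumes der: "\<And>t. (g has_real_derivative g' t) (at t)"
    and bound: "\<And>t. 0 \<le> t \<Longrightarrow> t \<le> 1 \<Longrightarrow> g' t \<le> g' 0 + m * t"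
  shows "g 1 \<le> g 0 + g' 0 + m / 2"
proof -
  define h where "h t = g' 0 * t + m / 2 * t\<^sup>2 - g t" for t
  have "h 0 \<le> h 1"
  proof (rule DERIV_nonneg_imp_nondecreasing[of 0 1 h])
    fix t :: real assume "0 \<le> t" "t \<le> 1"
    moreover have "(h has_real_derivative (g' 0 + m * t - g' t)) (at t)"
      unfolding h_def by (auto intro!: derivative_eq_intros der)
    ultimately show "\<exists>y. (h has_real_derivative y) (at t) \<and> 0 \<le> y"
      using bound[of t] by (auto intro!: exI[of _ "g' 0 + m * t - g' t"])
  qed simp
  then show ?thesis by (simp add: h_def)
qed

lemma GDERIV_line:
  assumes "\<And>Y. GDERIV f Y :> grad Y"
  shows "((\<lambda>t. f (Y + t *\<^sub>R E)) has_real_derivative grad (Y + t *\<^sub>R E) \<bullet> E) (at t)"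
proof -
  have "((\<lambda>t. Y + t *\<^sub>R E) has_derivative (\<lambda>h. h *\<^sub>R E)) (at t)"
    by (auto intro!: derivative_eq_intros)
  from has_derivative_compose[OF this assms[unfolded gderiv_def]] show ?thesis
    by (simp add: has_field_derivative_def inner_commute mult.commute[of _ "_ \<bullet> _"] inner_scaleR_left)
qed

text \<open>The descent lemma, with the Lipschitz bound asked only along the segment, so that a rank
  bound on its points is enough to apply A1.\<close>

lemma smooth_upper_bound:
  assumes grad: "\<And>Y. GDERIV f Y :> grad Y"
    and smooth: "\<And>t. 0 \<le> t \<Longrightarrow> t \<le> 1 \<Longrightarrow> norm (grad (Y + t *\<^sub>R E) - grad Y) \<le> L * norm (t *\<^sub>R E)"
  shows "f (Y + E) \<le> f Y + grad Y \<bullet> E + L / 2 * (norm E)\<^sup>2"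
proof -
  have "grad (Y + t *\<^sub>R E) \<bullet> E \<le> grad (Y + 0 *\<^sub>R E) \<bullet> E + L * (norm E)\<^sup>2 * t" if "0 \<le> t" "t \<le> 1" for t
  proof -
    have "(grad (Y + t *\<^sub>R E) - grad Y) \<bullet> E \<le> norm (grad (Y + t *\<^sub>R E) - grad Y) * norm E"
      by (rule norm_cauchy_schwarz)
    also have "\<dots> \<le> L * norm (t *\<^sub>R E) * norm E"
      using smooth[OF that] by (intro mult_right_mono) auto
    finally show ?thesis
      using that by (simp add: inner_diff_left power2_eq_square mult_ac)
  qed
  from upper_quadratic_bound[OF GDERIV_line[OF grad] this] show ?thesis
    by simp
qed

text \<open>The Hessian bound is integrated twice along the segment: first to the directional
  derivative, then to \<open>f\<close>.\<close>

lemma strongly_convex_lower_bound: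
  assumes grad: "\<And>Y. GDERIV f Y :> grad Y"
    and hess: "\<And>Y. (grad has_derivative hess Y) (at Y)"
    and convex: "\<And>t. 0 \<le> t \<Longrightarrow> t \<le> 1 \<Longrightarrow> \<mu> * (norm E)\<^sup>2 \<le> hess (Y + t *\<^sub>R E) E \<bullet> E"
  shows "f Y + grad Y \<bullet> E + \<mu> / 2 * (norm E)\<^sup>2 \<le> f (Y + E)"
proof -
  let ?g = "\<lambda>t. grad (Y + t *\<^sub>R E) \<bullet> E"
  have der: "(?g has_real_derivative hess (Y + t *\<^sub>R E) E \<bullet> E) (at t)" for t
  proof -
    have "((\<lambda>t. Y + t *\<^sub>R E) has_derivative (\<lambda>h. h *\<^sub>R E)) (at t)"
      by (auto intro!: derivative_eq_intros)
    from has_derivative_inner_left[OF has_derivative_compose[OF this hess]]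
    show ?thesis
      using linear_scale[OF has_derivative_linear[OF hess]]
      by (simp add: has_field_derivative_def mult.commute[of _ "_ \<bullet> _"])
  qed
  have "- ?g t \<le> - ?g 0 + - (\<mu> * (norm E)\<^sup>2) * t" if "0 \<le> t" "t \<le> 1" for t
  proof -
    define h where "h t = ?g t - \<mu> * (norm E)\<^sup>2 * t" for t
    have "h 0 \<le> h t"
    proof (rule DERIV_nonneg_imp_nondecreasing[OF that(1)])
      fix u assume u: "0 \<le> u" "u \<le> t"
      have "(h has_real_derivative (hess (Y + u *\<^sub>R E) E \<bullet> E - \<mu> * (norm E)\<^sup>2)) (at u)"
        unfolding h_def by (auto intro!: derivative_eq_intros der)
      then show "\<exists>y. (h has_real_derivative y) (at u) \<and> 0 \<le> y"
        using convex[of u] u that by (auto intro!: exI[of _ "hess (Y + u *\<^sub>R E) E \<bullet> E - \<mu> * (norm E)\<^sup>2"])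
    qed
    then show ?thesis by (simp add: h_def)
  qed
  from upper_quadratic_bound[OF DERIV_minus[OF GDERIV_line[OF grad]] this] show ?thesis
    by simp
qed

section \<open>A single projected gradient step under Assumptions A1 and A2\<close>

locale rank_restricted_convex =
  fixes f :: "real^'n^'n \<Rightarrow> real"
    and grad :: "real^'n^'n \<Rightarrow> real^'n^'n"
    and hess :: "real^'n^'n \<Rightarrow> real^'n^'n \<Rightarrow> real^'n^'n"
    and L \<mu> :: real
    and r :: nat
    and Xs :: "real^'n^'n"
  assumes grad: "\<And>Y. GDERIV f Y :> grad Y"
    and hess: "\<And>Y. (grad has_derivative hess Y) (at Y)"
    and constants: "0 < \<mu>" "\<mu> \<le> L"
    and smooth: "\<And>Y Y'. rank Y \<le> 2 * r \<Longrightarrow> rank Y' \<le> 2 * r \<Longrightarrow>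
                      norm (grad Y - grad Y') \<le> L * norm (Y - Y')"
    and convex: "\<And>Y E. rank Y \<le> 2 * r \<Longrightarrow> rank E \<le> 2 * r \<Longrightarrow>
                      hess Y E \<bullet> E \<ge> \<mu> * (norm E)\<^sup>2"
    and minimizer: "\<And>Y. f Xs \<le> f Y"
    and rank_minimizer: "rank Xs \<le> r"
begin

lemma L_pos: "0 < L"
  using constants by linarith

lemma grad_minimizer: "grad Xs = 0"
proof -
  have "(\<lambda>h. h \<bullet> grad Xs) = (\<lambda>h. 0)"
    using differential_zero_maxmin[of Xs UNIV f "\<lambda>h. h \<bullet> grad Xs"] grad[of Xs] minimizer
    by (simp add: gderiv_def)
  then show ?thesis
    by (metis inner_eq_zero_iff)
qed

lemma upper_bound:
  assumes "rank Y \<le> r" "rank E \<le> r"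
  shows "f (Y + E) \<le> f Y + grad Y \<bullet> E + L / 2 * (norm E)\<^sup>2"
proof (rule smooth_upper_bound[OF grad])
  fix t :: real
  have "rank (Y + t *\<^sub>R E) \<le> 2 * r"
    using rank_add_le[of Y "t *\<^sub>R E"] rank_scaleR_le[of t E] assms by linarith
  then show "norm (grad (Y + t *\<^sub>R E) - grad Y) \<le> L * norm (t *\<^sub>R E)"
    using smooth[of "Y + t *\<^sub>R E" Y] assms by simp
qed

text \<open>The direction \<open>Z - Y\<close> may have rank up to \<open>2 * r\<close>, but every
  point of the segment combines \<open>Y\<close> and \<open>Z\<close>, so A1 still applies
  there.\<close>

lemma upper_bound_diff:
  assumes "rank Y \<le> r" "rank Z \<le> r"
  shows "f Z \<le> f Y + grad Y \<bullet> (Z - Y) + L / 2 * (norm (Z - Y))\<^sup>2"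
proof -
  have "f (Y + (Z - Y)) \<le> f Y + grad Y \<bullet> (Z - Y) + L / 2 * (norm (Z - Y))\<^sup>2"
  proof (rule smooth_upper_bound[OF grad])
    fix t :: real
    have "rank (Y + t *\<^sub>R (Z - Y)) \<le> 2 * r"
      using rank_segment_le[of Y t Z] assms by linarith
    then show "norm (grad (Y + t *\<^sub>R (Z - Y)) - grad Y) \<le> L * norm (t *\<^sub>R (Z - Y))"
      using smooth[of "Y + t *\<^sub>R (Z - Y)" Y] assms by simp
  qed
  then show ?thesis by simp
qed

lemma lower_bound:
  assumes "rank Y \<le> r" "rank Z \<le> r"
  shows "f Y + grad Y \<bullet> (Z - Y) + \<mu> / 2 * (norm (Z - Y))\<^sup>2 \<le> f Z"
proof -
  have "f Y + grad Y \<bullet> (Z - Y) + \<mu> / 2 * (norm (Z - Y))\<^sup>2 \<le> f (Y + (Z - Y))"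
  proof (rule strongly_convex_lower_bound[OF grad hess])
    fix t :: real
    have "rank (Y + t *\<^sub>R (Z - Y)) \<le> 2 * r"
      using rank_segment_le[of Y t Z] assms by linarith
    moreover have "rank (Z - Y) \<le> 2 * r"
      using rank_diff_le[of Z Y] assms by linarith
    ultimately show "\<mu> * (norm (Z - Y))\<^sup>2 \<le> hess (Y + t *\<^sub>R (Z - Y)) (Z - Y) \<bullet> (Z - Y)"
      by (rule convex)
  qed
  then show ?thesis by simp
qed

lemma quadratic_growth: "rank Y \<le> r \<Longrightarrow> \<mu> / 2 * (norm (Y - Xs))\<^sup>2 \<le> f Y - f Xs"
  using lower_bound[OF rank_minimizer, of Y] by (simp add: grad_minimizer)

text \<open>The quadratic upper model along the line through \<open>Y\<close> in direction
  \<open>E\<close> cannot fall below \<open>f Xs\<close>. Minimality over all matrices enters here,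
  since the trial point may have rank above \<open>r\<close>.\<close>

lemma gradient_low_rank_bound:
  assumes "rank Y \<le> r" "rank E \<le> r"
  shows "(grad Y \<bullet> E)\<^sup>2 \<le> 2 * L * (f Y - f Xs) * (norm E)\<^sup>2"
proof (cases "E = 0")
  case False
  define g where "g = grad Y \<bullet> E"
  define c where "c = L * (norm E)\<^sup>2"
  have c: "c > 0"
    using False L_pos by (simp add: c_def)
  \<comment> \<open>The minimiser of \<open>t * g + c / 2 * t\<^sup>2\<close>.\<close>
  define t where "t = - g / c"
  have "f Xs \<le> f (Y + t *\<^sub>R E)"
    by (rule minimizer)
  also have "\<dots> \<le> f Y + grad Y \<bullet> (t *\<^sub>R E) + L / 2 * (norm (t *\<^sub>R E))\<^sup>2"
    using assms rank_scaleR_le[of t E] by (intro upper_bound) auto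
  also have "\<dots> = f Y + t * g + c / 2 * t\<^sup>2"
    by (simp add: g_def c_def power_mult_distrib)
  also have "\<dots> = f Y - g\<^sup>2 / (2 * c)"
    using c by (simp add: t_def field_simps power2_eq_square)
  finally have "g\<^sup>2 / (2 * c) \<le> f Y - f Xs" by simp
  then have "g\<^sup>2 \<le> (f Y - f Xs) * (2 * c)"
    using c by (simp add: pos_divide_le_eq)
  then show ?thesis
    unfolding g_def c_def by (simp only: mult_ac)
qed simp

text \<open>Completing the square shows that projecting the gradient step minimises the quadratic
  model over rank at most \<open>r\<close>; the model dominates \<open>f\<close> there because
  \<open>L \<le> 1 / \<eta>\<close>.\<close>

lemma projected_step_le:
  assumes \<eta>: "0 < \<eta>" "\<eta> * L \<le> 1"
    and Y: "rank Y \<le> r" and W: "rank W \<le> r"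
    and Z: "is_rank_projection r (Y - \<eta> *\<^sub>R grad Y) Z"
  shows "f Z \<le> f Y + grad Y \<bullet> (W - Y) + (norm (W - Y))\<^sup>2 / (2 * \<eta>)"
proof -
  have rankZ: "rank Z \<le> r"
    and "norm (Y - \<eta> *\<^sub>R grad Y - Z) \<le> norm (Y - \<eta> *\<^sub>R grad Y - W)"
    using Z W unfolding is_rank_projection_def is_arg_min_linorder by auto
  then have "(norm (Y - \<eta> *\<^sub>R grad Y - Z))\<^sup>2 \<le> (norm (Y - \<eta> *\<^sub>R grad Y - W))\<^sup>2"
    by (intro power_mono) auto
  \<comment> \<open>Up to a term independent of \<open>V\<close>, the squared distance is
    \<open>2 * \<eta>\<close> times the model.\<close>
  moreover have "(norm (Y - \<eta> *\<^sub>R grad Y - V))\<^sup>2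
      = (norm (V - Y))\<^sup>2 + 2 * \<eta> * (grad Y \<bullet> (V - Y)) + \<eta>\<^sup>2 * (norm (grad Y))\<^sup>2" for V
    unfolding power2_norm_eq_inner
    by (simp add: inner_diff inner_commute algebra_simps power2_eq_square)
  ultimately have "(norm (Z - Y))\<^sup>2 + 2 * \<eta> * (grad Y \<bullet> (Z - Y)) \<le> (norm (W - Y))\<^sup>2 + 2 * \<eta> * (grad Y \<bullet> (W - Y))"
    by simp
  then have "((norm (Z - Y))\<^sup>2 + 2 * \<eta> * (grad Y \<bullet> (Z - Y))) / (2 * \<eta>) \<le> ((norm (W - Y))\<^sup>2 + 2 * \<eta> * (grad Y \<bullet> (W - Y))) / (2 * \<eta>)"
    using \<eta>(1) by (intro divide_right_mono) auto
  then have min: "(norm (Z - Y))\<^sup>2 / (2 * \<eta>) + grad Y \<bullet> (Z - Y) \<le> (norm (W - Y))\<^sup>2 / (2 * \<eta>) + grad Y \<bullet> (W - Y)"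
    using \<eta>(1) by (simp add: add_divide_distrib)
  have "L / 2 \<le> 1 / (2 * \<eta>)"
    using \<eta> by (simp add: field_simps)
  then have "L / 2 * (norm (Z - Y))\<^sup>2 \<le> 1 / (2 * \<eta>) * (norm (Z - Y))\<^sup>2"
    by (rule mult_right_mono) simp
  then show ?thesis
    using upper_bound_diff[OF Y rankZ] min by simp
qed

text \<open>The pairing of \<open>G\<close> with \<open>D - N\<close> is at least
  \<open>7 / 10 * \<Delta> + \<mu> / 2 * d\<close>, and its square is at most
  \<open>2 * s\<^sup>2 * d\<close>; the inequality of arithmetic and geometric means then lets
  \<open>d\<close> cancel. The hypothesis \<open>close\<close> is the initialisation bound cleared
  of denominators.\<close>

lemma tangent_gradient_bound:
  assumes Y: "rank Y \<le> r"
    and P: "orthogonal_projector P" "P ** Y = Y"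
    and Q: "orthogonal_projector Q" "Y ** Q = Y"
    and s: "norm (P ** grad Y) \<le> s" "norm (grad Y ** Q) \<le> s"
    and close: "100 * L * (f Y - f Xs) \<le> \<mu>\<^sup>2 * (singular_value (rank Xs) Xs)\<^sup>2"
    and gap: "f Xs < f Y"
  shows "7 / 10 * \<mu> * (f Y - f Xs) \<le> s\<^sup>2"
proof -
  define \<Delta> where "\<Delta> = f Y - f Xs"
  define G where "G = grad Y"
  define D where "D = Y - Xs"
  define M where "M = D - P ** D"
  define N where "N = M - M ** Q"
  define \<sigma> where "\<sigma> = singular_value (rank Xs) Xs"
  define d where "d = (norm D)\<^sup>2"
  have \<Delta>: "\<Delta> > 0"
    using gap by (simp add: \<Delta>_def)
  have growth: "\<mu> / 2 * d \<le> \<Delta>"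
    using quadratic_growth[OF Y] by (simp add: d_def D_def \<Delta>_def)
  have lower: "\<Delta> + \<mu> / 2 * d \<le> G \<bullet> D"
    using lower_bound[OF Y rank_minimizer]
    by (simp add: d_def D_def \<Delta>_def G_def inner_diff_right norm_minus_commute)
  have M: "M = - (Xs - P ** Xs)"
    by (simp add: M_def D_def matrix_mult_diff_distrib P(2))
  have N: "N = - ((Xs - P ** Xs) - (Xs - P ** Xs) ** Q)"
    unfolding N_def M matrix_mult_minus_left by simp
  have "\<sigma> * norm N \<le> d"
    using normal_component_bound[OF P Q singular_value_nonneg singular_value_rank_le, of Xs]
    unfolding N norm_minus_cancel d_def D_def \<sigma>_def by simp
  then have "(\<sigma> * norm N)\<^sup>2 \<le> d\<^sup>2"
    by (intro power_mono) (auto simp: \<sigma>_def singular_value_nonneg)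
  then have "\<mu>\<^sup>2 * (\<sigma> * norm N)\<^sup>2 \<le> \<mu>\<^sup>2 * d\<^sup>2"
    by (rule mult_left_mono) simp
  also have "\<dots> = 4 * (\<mu> / 2 * d)\<^sup>2"
    by (simp add: power_mult_distrib power_divide)
  also have "\<dots> \<le> 4 * \<Delta>\<^sup>2"
    using growth constants(1) by (intro mult_left_mono power_mono) (auto simp: d_def)
  finally have sN: "\<mu>\<^sup>2 * \<sigma>\<^sup>2 * (norm N)\<^sup>2 \<le> 4 * \<Delta>\<^sup>2"
    by (simp add: power_mult_distrib mult_ac)
  \<comment> \<open>Closeness trades \<open>\<mu>\<^sup>2 * \<sigma>\<^sup>2\<close> for
    \<open>100 * L * \<Delta>\<close>, the scale of the gradient bound on low-rank
    directions.\<close>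
  have "100 * L * \<Delta> * (norm N)\<^sup>2 \<le> \<mu>\<^sup>2 * \<sigma>\<^sup>2 * (norm N)\<^sup>2"
    using close by (intro mult_right_mono) (auto simp: \<Delta>_def \<sigma>_def)
  with sN have LN: "100 * (L * \<Delta> * (norm N)\<^sup>2) \<le> 4 * \<Delta>\<^sup>2"
    by simp
  \<comment> \<open>\<open>N\<close> is, up to sign, \<open>Xs\<close> multiplied by complementary
    projectors, so it inherits the rank bound of \<open>Xs\<close>.\<close>
  have "rank N \<le> r"
  proof -
    have "N = - (mat 1 - P) ** Xs ** (mat 1 - Q)"
      unfolding N matrix_mult_minus_left by (simp add: matrix_mult_diff_rdistrib matrix_mult_diff_distrib)
    then have "rank N \<le> rank (- (mat 1 - P) ** Xs)"
      using rank_mul_le_left by metis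
    also have "\<dots> \<le> rank Xs"
      by (rule rank_mul_le_right)
    finally show ?thesis using rank_minimizer by simp
  qed
  from gradient_low_rank_bound[OF Y this]
  have "(G \<bullet> N)\<^sup>2 \<le> 2 * (L * \<Delta> * (norm N)\<^sup>2)"
    unfolding G_def \<Delta>_def by (simp only: mult_ac)
  \<comment> \<open>\<open>LN\<close> yields \<open>8 / 100 * \<Delta>\<^sup>2\<close>, within the
    \<open>9 / 100\<close> allowed by the square.\<close>
  also have "\<dots> \<le> (3 / 10 * \<Delta>)\<^sup>2"
    using LN by (simp add: power_mult_distrib power_divide) (use zero_le_power2[of \<Delta>] in linarith)
  finally have "\<bar>G \<bullet> N\<bar> \<le> 3 / 10 * \<Delta>"
    using \<Delta> by (simp add: abs_le_square_iff[symmetric])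
  then have "7 / 10 * \<Delta> + \<mu> / 2 * d \<le> G \<bullet> D - G \<bullet> N"
    using lower by linarith
  moreover have "0 \<le> 7 / 10 * \<Delta> + \<mu> / 2 * d"
    using \<Delta> constants(1) by (simp add: d_def)
  ultimately have "(7 / 10 * \<Delta> + \<mu> / 2 * d)\<^sup>2 \<le> (G \<bullet> D - G \<bullet> N)\<^sup>2"
    by (intro power_mono)
  also have "\<dots> \<le> 2 * s\<^sup>2 * d"
    using inner_tangent_part_bound[OF P(1) Q(1) s, of D]
    by (simp add: G_def N_def M_def d_def)
  finally have "(7 / 10 * \<Delta> + \<mu> / 2 * d)\<^sup>2 \<le> 2 * s\<^sup>2 * d" .
  \<comment> \<open>Four times the product of the summands is at most the square of their sum, and
    \<open>4 * (7 / 10) * (1 / 2) = 7 / 5\<close>.\<close>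
  moreover have "7 / 5 * \<mu> * \<Delta> * d \<le> (7 / 10 * \<Delta> + \<mu> / 2 * d)\<^sup>2"
    using zero_le_power2[of "7 / 10 * \<Delta> - \<mu> / 2 * d"] by (simp add: power2_eq_square algebra_simps)
  ultimately have "(7 / 5 * \<mu> * \<Delta>) * d \<le> (2 * s\<^sup>2) * d"
    by linarith
  \<comment> \<open>\<open>d = 0\<close> would mean \<open>Y = Xs\<close>, contrary to
    \<open>gap\<close>.\<close>
  moreover have "d > 0"
    using gap by (auto simp: d_def D_def)
  ultimately have "7 / 5 * \<mu> * \<Delta> \<le> 2 * s\<^sup>2"
    by (rule mult_right_le_imp_le)
  then show ?thesis by (simp add: \<Delta>_def)
qed

lemma projected_step_contracts:
  assumes \<eta>: "0 < \<eta>" "\<eta> * L \<le> 1"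
    and Y: "rank Y \<le> r"
    and close: "100 * L * (f Y - f Xs) \<le> \<mu>\<^sup>2 * (singular_value (rank Xs) Xs)\<^sup>2"
    and Z: "is_rank_projection r (Y - \<eta> *\<^sub>R grad Y) Z"
  shows "f Z - f Xs \<le> (1 - 7 / 20 * \<eta> * \<mu>) * (f Y - f Xs)"
proof (cases "f Xs < f Y")
  case False
  \<comment> \<open>At the minimal value, \<open>Y\<close> itself as competitor shows that the step
    does not increase \<open>f\<close>.\<close>
  then have "f Y = f Xs"
    using minimizer[of Y] by simp
  then show ?thesis
    using projected_step_le[OF \<eta> Y Y Z] by simp
next
  case True
  obtain P where P: "orthogonal_projector P" "P ** Y = Y" "rank P \<le> rank Y"
    by (rule ex_column_space_projector)
  obtain Q where Q: "orthogonal_projector Q" "Y ** Q = Y" "rank Q \<le> rank Y"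
    by (rule ex_row_space_projector)
  \<comment> \<open>For the competitor \<open>Y - \<eta> *\<^sub>R H\<close> the linear term
    contributes \<open>- \<eta>\<close> and the quadratic term \<open>\<eta> / 2\<close> times the
    squared norm of \<open>H\<close>.\<close>
  have descent: "f Z \<le> f Y - \<eta> / 2 * (norm H)\<^sup>2"
    if "rank (Y - \<eta> *\<^sub>R H) \<le> r" "grad Y \<bullet> H = H \<bullet> H" for H
  proof -
    have "f Z \<le> f Y + grad Y \<bullet> (- \<eta> *\<^sub>R H) + (norm (\<eta> *\<^sub>R H))\<^sup>2 / (2 * \<eta>)"
      using projected_step_le[OF \<eta> Y that(1) Z] by simp
    also have "\<dots> = f Y - \<eta> / 2 * (norm H)\<^sup>2"
      using \<eta>(1) by (simp add: that(2) power_mult_distrib field_simps flip: power2_norm_eq_inner)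
         (simp add: power2_eq_square)
    finally show ?thesis .
  qed
  have dP: "f Z \<le> f Y - \<eta> / 2 * (norm (P ** grad Y))\<^sup>2"
  proof (rule descent)
    \<comment> \<open>As \<open>P\<close> fixes \<open>Y\<close>, the competitor is a multiple of
      \<open>P\<close> and its rank is at most that of \<open>P\<close>.\<close>
    have "Y - \<eta> *\<^sub>R (P ** grad Y) = P ** (Y - \<eta> *\<^sub>R grad Y)"
      by (simp add: matrix_mult_diff_distrib matrix_mult_scaleR_right P(2))
    then show "rank (Y - \<eta> *\<^sub>R (P ** grad Y)) \<le> r"
      using rank_mul_le_left[of P] P(3) Y by (metis order_trans)
  qed (simp add: orthogonal_projector_inner[OF P(1)])
  have dQ: "f Z \<le> f Y - \<eta> / 2 * (norm (grad Y ** Q))\<^sup>2"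
  proof (rule descent)
    have "Y - \<eta> *\<^sub>R (grad Y ** Q) = (Y - \<eta> *\<^sub>R grad Y) ** Q"
      by (simp add: matrix_mult_diff_rdistrib matrix_mult_scaleR_left Q(2))
    then show "rank (Y - \<eta> *\<^sub>R (grad Y ** Q)) \<le> r"
      using rank_mul_le_right[of _ Q] Q(3) Y by (metis order_trans)
  qed (simp add: orthogonal_projector_inner_right[OF Q(1)])
  \<comment> \<open>One \<open>s\<close> dominating both norms, and still realised as a decrease by
    one of the two competitors.\<close>
  define s where "s = max (norm (P ** grad Y)) (norm (grad Y ** Q))"
  have "7 / 10 * \<mu> * (f Y - f Xs) \<le> s\<^sup>2"
    using tangent_gradient_bound[OF Y P(1,2) Q(1,2) _ _ close True, of s] by (simp add: s_def)
  then have "\<eta> / 2 * (7 / 10 * \<mu> * (f Y - f Xs)) \<le> \<eta> / 2 * s\<^sup>2"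
    using \<eta>(1) by (intro mult_left_mono) auto
  moreover have "f Z \<le> f Y - \<eta> / 2 * s\<^sup>2"
    using dP dQ by (simp add: s_def max_def)
  moreover have "(1 - 7 / 20 * \<eta> * \<mu>) * x = x - \<eta> / 2 * (7 / 10 * \<mu> * x)" for x
    by (simp add: field_simps)
  ultimately show ?thesis
    by simp
qed

end

section \<open>Iterating the step: linear convergence to \<open>Xs\<close>\<close>

theorem theorem1:
  fixes f :: "real^'n^'n \<Rightarrow> real"
    and grad :: "real^'n^'n \<Rightarrow> real^'n^'n"
    and hess :: "real^'n^'n \<Rightarrow> real^'n^'n \<Rightarrow> real^'n^'n"
    and L \<mu> \<kappa> \<eta> :: real
    and r rs :: nat
    and Xs :: "real^'n^'n"
    and X :: "nat \<Rightarrow> real^'n^'n"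
  assumes r: "1 \<le> r" "r < CARD('n)"
    and grad: "\<And>Y. GDERIV f Y :> grad Y"
    and hess: "\<And>Y. (grad has_derivative hess Y) (at Y)"
    and constants: "0 < \<mu>" "\<mu> \<le> L"
    and A1_smooth: "\<And>Y Y'. rank Y \<le> 2 * r \<Longrightarrow> rank Y' \<le> 2 * r \<Longrightarrow>
                      norm (grad Y - grad Y') \<le> L * norm (Y - Y')"
    and A1_convex: "\<And>Y E. rank Y \<le> 2 * r \<Longrightarrow> rank E \<le> 2 * r \<Longrightarrow>
                      hess Y E \<bullet> E \<ge> \<mu> * (norm E)\<^sup>2"
    and A2_min: "\<And>Y. f Xs \<le> f Y"
    and A2_rank: "rank Xs = rs" "rs \<le> r"
    and \<kappa>: "\<kappa> = L / \<mu>"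
    and init_rank: "rank (X 0) \<le> r"
    and init: "f (X 0) - f Xs \<le> 1 / 100 * (singular_value rs Xs)\<^sup>2 * \<mu> / \<kappa>"
    and \<eta>: "0 < \<eta>" "\<eta> < 1 / (2 * L)"
    and iter: "\<And>k. is_rank_projection r (X k - \<eta> *\<^sub>R grad (X k)) (X (Suc k))"
  shows "converges_linearly X Xs \<and>
         (\<forall>k. f (X k) \<noteq> f Xs \<longrightarrow>
            (f (X (Suc k)) - f Xs) / (f (X k) - f Xs)
              \<le> 1 - 4 / (27 * \<kappa>) * (\<eta> * L - \<eta>\<^sup>2 * L\<^sup>2))"
proof -
  interpret rank_restricted_convex f grad hess L \<mu> r Xs
    using grad hess constants A1_smooth A1_convex A2_min A2_rank by unfold_locales auto
  define q where "q = 1 - 4 / (27 * \<kappa>) * (\<eta> * L - \<eta>\<^sup>2 * L\<^sup>2)"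
  have \<eta>L: "0 < \<eta> * L" "\<eta> * L < 1 / 2"
    using \<eta> L_pos by (auto simp: field_simps)
  have \<eta>\<mu>: "0 < \<eta> * \<mu>" "\<eta> * \<mu> < 1 / 2"
    using \<eta>(1) constants(1) \<eta>L(2) mult_left_mono[OF constants(2), of \<eta>] by (simp, linarith)
  \<comment> \<open>Since \<open>\<kappa> = L / \<mu>\<close>, the factor
    \<open>\<eta> * L / \<kappa>\<close> equals \<open>\<eta> * \<mu>\<close>.\<close>
  have q: "q = 1 - \<eta> * \<mu> * (4 / 27 * (1 - \<eta> * L))"
    using L_pos constants(1) by (simp add: q_def \<kappa> field_simps power2_eq_square)
  have q1: "q < 1" and q0: "0 \<le> q" and rate: "1 - 7 / 20 * \<eta> * \<mu> \<le> q"
  proof -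
    \<comment> \<open>The stated rate is weaker than the one-step rate: \<open>4 / 27\<close> is
      already below \<open>7 / 20\<close>.\<close>
    have c: "0 < 4 / 27 * (1 - \<eta> * L)" "4 / 27 * (1 - \<eta> * L) \<le> 7 / 20"
      using \<eta>L by auto
    show "q < 1"
      unfolding q using c(1) \<eta>\<mu>(1) by simp
    show rate: "1 - 7 / 20 * \<eta> * \<mu> \<le> q"
      unfolding q using mult_left_mono[OF c(2), of "\<eta> * \<mu>"] \<eta>\<mu>(1) by (simp add: mult_ac)
    show "0 \<le> q"
      using rate \<eta>\<mu>(2) by simp
  qed
  have close0: "100 * L * (f (X 0) - f Xs) \<le> \<mu>\<^sup>2 * (singular_value (rank Xs) Xs)\<^sup>2"
    using init L_pos constants(1) by (simp add: \<kappa> A2_rank(1) field_simps power2_eq_square)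
  have rank: "rank (X k) \<le> r" for k
  proof (cases k)
    case (Suc j)
    then show ?thesis
      using iter[of j] by (simp add: is_rank_projection_def is_arg_min_def)
  qed (use init_rank in simp)
  \<comment> \<open>Closeness depends only on the function value, so it passes from
    \<open>X 0\<close> to any iterate that is no higher; the induction below shows that all
    are.\<close>
  have step_if: "f (X (Suc k)) - f Xs \<le> q * (f (X k) - f Xs)"
    if "f (X k) \<le> f (X 0)" for k
  proof -
    have "100 * L * (f (X k) - f Xs) \<le> 100 * L * (f (X 0) - f Xs)"
      using that L_pos by (intro mult_left_mono) auto
    then have "f (X (Suc k)) - f Xs \<le> (1 - 7 / 20 * \<eta> * \<mu>) * (f (X k) - f Xs)"
      using \<eta>(1) \<eta>L rank iter close0 by (intro projected_step_contracts) auto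
    also have "\<dots> \<le> q * (f (X k) - f Xs)"
      using rate A2_min by (intro mult_right_mono) auto
    finally show ?thesis .
  qed
  have bounded: "f (X k) \<le> f (X 0)" for k
  proof (induction k)
    case (Suc k)
    have "q * (f (X k) - f Xs) \<le> f (X k) - f Xs"
      using mult_right_mono[of q 1 "f (X k) - f Xs"] q1 A2_min[of "X k"] by simp
    with step_if[OF Suc.IH] have "f (X (Suc k)) - f Xs \<le> f (X k) - f Xs"
      by (rule order_trans)
    then show ?case
      using Suc.IH by simp
  qed simp
  have step: "f (X (Suc k)) - f Xs \<le> q * (f (X k) - f Xs)" for k
    using step_if bounded by blast
  have geometric: "f (X k) - f Xs \<le> (f (X 0) - f Xs) * q ^ k" for k
  proof (induction k)
    case (Suc k)
    have "q * (f (X k) - f Xs) \<le> q * ((f (X 0) - f Xs) * q ^ k)"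
      using Suc.IH q0 by (rule mult_left_mono)
    then show ?case
      using step[of k] by (simp add: mult_ac)
  qed simp
  \<comment> \<open>Quadratic growth bounds the squared distance by the gap, so the distance decays
    with ratio \<open>sqrt q\<close>.\<close>
  have "norm (X k - Xs) \<le> sqrt (2 / \<mu> * (f (X 0) - f Xs)) * sqrt q ^ k" for k
  proof -
    have "\<mu> / 2 * (norm (X k - Xs))\<^sup>2 \<le> (f (X 0) - f Xs) * q ^ k"
      using quadratic_growth[OF rank] geometric by (rule order_trans)
    then have "(norm (X k - Xs))\<^sup>2 \<le> 2 / \<mu> * (f (X 0) - f Xs) * q ^ k"
      using constants(1) by (simp add: field_simps)
    from real_le_rsqrt[OF this] show ?thesis
      by (simp only: real_sqrt_mult real_sqrt_power)
  qed
  moreover have "0 \<le> sqrt q" "sqrt q < 1"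
    using q0 q1 by auto
  ultimately have "converges_linearly X Xs"
    unfolding converges_linearly_def by blast
  moreover have "(f (X (Suc k)) - f Xs) / (f (X k) - f Xs) \<le> q" if "f (X k) \<noteq> f Xs" for k
  proof -
    have "0 < f (X k) - f Xs"
      using that A2_min[of "X k"] by simp
    then show ?thesis
      using step[of k] by (simp add: pos_divide_le_eq)
  qed
  ultimately show ?thesis
    by (simp add: q_def)
qed

end
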